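(* Let $f:\mathbb{R}^m\times\mathbb{R}^n\to\mathbb{R}$ satisfy the standing assumptions (continuously differentiable, convex-concave, Lipschitz partial gradients with constant $L$ as defined in the context, and nonempty set of saddle points), and let $F(z)=[\nabla_x f(x,y);-\nabla_y f(x,y)]$ for $z=[x;y]\in\mathbb{R}^{m+n}$. Let $(z_k)_{k\ge0}$ and $(z_{k+\frac12})_{k\ge 0}$ be generated by the extra-gradient (EG) method $$z_{k+\frac12}=z_k-\eta F(z_k),\qquad z_{k+1}=z_k-\eta F(z_{k+\frac12}),\qquad k\ge 0,$$ and suppose $0<\eta<\frac1L$. Then: (a) For every $z\in\mathbb{R}^{m+n}$ and every $k\ge 1$, $$F(z_{k+\frac12})^\top(z_{k+\frac12}-z)\le\frac{1}{2\eta}\|z_{k-\frac12}-z\|^2-\frac{1}{2\eta}\|z_{k+\frac12}-z\|^2+\frac L2\|z_{k-\frac12}-z_{k-1}\|^2$$ $$\qquad+(F(z_{k+\frac12})-F(z_k))^\top(z_{k+\frac12}-z)-(F(z_{k-\frac12})-F(z_{k-1}))^\top(z_{k-\frac12}-z).$$ (b) For any saddle point $z^*=(x^*,y^* )$ of $f$, writing $z_0=(x_0,y_0)$, the iterates $(z_k)$ and $(z_{k+\frac12})$ stay within the compact set $$\mathcal{D}:=\Big\{(x,y):\|x-x^*\|^2+\|y-y^*\|^2\le\Big(2+\frac{2}{1-\eta^2L^2}\Big)(\|x_0-x^*\|^2+\|y_0-y^*\|^2)\Big\}.$$ Moreover, $$\sum_{k=0}^{\infty}\|z_{k+\frac12}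-z_k\|^2\le\frac{\|z_0-z^*\|^2}{1-\eta^2L^2}.$$
   Context: Norms are Euclidean. A saddle point of $f$ is a pair $(x^*,y^* )\in\mathbb{R}^m\times\mathbb{R}^n$ with $f(x^*,y)\le f(x^*,y^* )\le f(x,y^* )$ for all $x\in\mathbb{R}^m$, $y\in\mathbb{R}^n$. Standing assumptions on $f$: (1) $f$ is continuously differentiable in $x$ and $y$; $f(\cdot,y)$ is convex for every $y\in\mathbb{R}^n$ and $f(x,\cdot)$ is concave for every $x\in\mathbb{R}^m$. (2) There are constants $L_{xx},L_{xy},L_{yx},L_{yy}$ such that for all arguments $\|\nabla_x f(x_1,y)-\nabla_x f(x_2,y)\|\le L_{xx}\|x_1-x_2\|$, $\|\nabla_x f(x,y_1)-\nabla_x f(x,y_2)\|\le L_{xy}\|y_1-y_2\|$, $\|\nabla_y f(x,y_1)-\nabla_y f(x,y_2)\|\le L_{yy}\|y_1-y_2\|$, $\|\nabla_y f(x_1,y)-\nabla_y f(x_2,y)\|\le L_{yx}\|x_1-x_2\|$; and $L:=2\max\{L_{xx},L_{xy},L_{yx},L_{yy}\}$. (3) The set $\mathcal{Z}^*$ of saddle points of $f$ is nonempty. *)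

theory Defs
  imports "HOL-Analysis.Analysis"
begin

definition gradient :: "('a::real_inner \<Rightarrow> real) \<Rightarrow> 'a \<Rightarrow> 'a" where
  "gradient g x = (THE D. GDERIV g x :> D)"

lemma GDERIV_unique:
  assumes "GDERIV g x :> D" "GDERIV g x :> E"
  shows "D = E"
proof -
  have "(\<lambda>h. h \<bullet> D) = (\<lambda>h. h \<bullet> E)"
    using assms unfolding gderiv_def by (rule has_derivative_unique)
  then have "h \<bullet> D = h \<bullet> E" for h
    by (rule fun_cong)
  then show ?thesis
    by (metis vector_eq_ldot)
qed

lemma GDERIV_imp_gradient: "GDERIV g x :> D \<Longrightarrow> gradient g x = D"
  unfolding gradient_def by (blast intro: GDERIV_unique)

lemma GDERIV_gradient:
  fixes g :: "'a::euclidean_space \<Rightarrow> real"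
  assumes "g differentiable (at x)"
  shows "GDERIV g x :> gradient g x"
proof -
  obtain g' where g': "(g has_derivative g') (at x)"
    using assms unfolding differentiable_def by blast
  then have "linear g'"
    by (rule has_derivative_linear)
  then have "g' = (\<lambda>h. h \<bullet> adjoint g' 1)"
    by (simp add: fun_eq_iff adjoint_works)
  then have "GDERIV g x :> adjoint g' 1"
    using g' unfolding gderiv_def by simp
  then show ?thesis
    by (metis GDERIV_imp_gradient)
qed

definition grad_x :: "('a::real_inner \<times> 'b::real_inner \<Rightarrow> real) \<Rightarrow> 'a \<times> 'b \<Rightarrow> 'a" where
  "grad_x f z = gradient (\<lambda>x. f (x, snd z)) (fst z)"

definition grad_y :: "('a::real_inner \<times> 'b::real_inner \<Rightarrow> real) \<Rightarrow> 'a \<times> 'b \<Rightarrow> 'b" where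
  "grad_y f z = gradient (\<lambda>y. f (fst z, y)) (snd z)"

text \<open>Continuous differentiability in the sense of partial gradients: both exist everywhere
  and are continuous as functions on the product space.\<close>

definition continuously_differentiable_xy ::
    "('a::real_inner \<times> 'b::real_inner \<Rightarrow> real) \<Rightarrow> bool" where
  "continuously_differentiable_xy f \<longleftrightarrow>
     (\<forall>x y. (\<lambda>x'. f (x', y)) differentiable (at x)) \<and>
     (\<forall>x y. (\<lambda>y'. f (x, y')) differentiable (at y)) \<and>
     continuous_on UNIV (grad_x f) \<and> continuous_on UNIV (grad_y f)"

definition convex_concave ::
    "('a::real_vector \<times> 'b::real_vector \<Rightarrow> real) \<Rightarrow> bool" where
  "convex_concave f \<longleftrightarrow>
     (\<forall>y. convex_on UNIV (\<lambda>x. f (x, y))) \<and> (\<forall>x. concave_on UNIV (\<lambda>y. f (x, y)))"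

definition saddle_points :: "('a \<times> 'b \<Rightarrow> real) \<Rightarrow> ('a \<times> 'b) set" where
  "saddle_points f =
     {(xs, ys). \<forall>x y. f (xs, y) \<le> f (xs, ys) \<and> f (xs, ys) \<le> f (x, ys)}"

definition saddle_operator ::
    "('a::real_inner \<times> 'b::real_inner \<Rightarrow> real) \<Rightarrow> 'a \<times> 'b \<Rightarrow> 'a \<times> 'b" where
  "saddle_operator f z = (grad_x f z, - grad_y f z)"

text \<open>The second sequence holds the half-step iterates: \<open>zh k\<close> is $z_{k+1/2}$.\<close>

definition extragradient_iterates ::
    "('v::real_vector \<Rightarrow> 'v) \<Rightarrow> real \<Rightarrow> (nat \<Rightarrow> 'v) \<Rightarrow> (nat \<Rightarrow> 'v) \<Rightarrow> bool" where
  "extragradient_iterates F \<eta> z zh \<longleftrightarrow>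
     (\<forall>k. zh k = z k - \<eta> *\<^sub>R F (z k) \<and> z (Suc k) = z k - \<eta> *\<^sub>R F (zh k))"

definition eg_region ::
    "real \<Rightarrow> real \<Rightarrow> 'a::real_normed_vector \<times> 'b::real_normed_vector \<Rightarrow> 'a \<times> 'b \<Rightarrow> ('a \<times> 'b) set"
  where
  "eg_region L \<eta> z0 zs =
     {(x, y). (norm (x - fst zs))\<^sup>2 + (norm (y - snd zs))\<^sup>2
        \<le> (2 + 2 / (1 - \<eta>\<^sup>2 * L\<^sup>2)) * ((norm (fst z0 - fst zs))\<^sup>2 + (norm (snd z0 - snd zs))\<^sup>2)}"

end

theory Submission
  imports Defs
begin

text \<open>
  Only two properties of the saddle operator \<open>F\<close> enter the argument: it is Lipschitz with
  constant \<open>L\<close> (\<open>saddle_operator_lipschitz\<close>), and \<open>F(z) \<bullet> (z - z\<^sup>*) \<ge> 0\<close> at every saddle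
  point \<open>z\<^sup>*\<close> (\<open>saddle_operator_inner_nonneg\<close>).  Everything else concerns extragradient iterates
  of an abstract operator in an inner product space.

  The inequality of part (a) comes from reading the method through its half-step iterates: with the
  drift \<open>e\<^sub>k = F(z\<^bsub>k+1/2\<^esub>) - F(z\<^sub>k)\<close>, one full step is an implicit (proximal point) step
  \<open>z\<^bsub>k+1/2\<^esub> = z\<^bsub>k-1/2\<^esub> - \<eta> (F(z\<^bsub>k+1/2\<^esub>) - e\<^sub>k + e\<^bsub>k-1\<^esub>)\<close>.  The three-point
  identity turns this into the claimed telescoping terms plus the two error terms.  The term
  \<open>\<parallel>z\<^bsub>k-1/2\<^esub> - z\<^bsub>k+1/2\<^esub>\<parallel>\<^sup>2 / (2\<eta>)\<close> that the implicit step gains, together with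
  \<open>L \<parallel>z\<^bsub>k-1/2\<^esub> - z\<^bsub>k-1\<^esub>\<parallel>\<^sup>2 / 2\<close>, pays for replacing \<open>e\<^bsub>k-1\<^esub> \<bullet> (z\<^bsub>k+1/2\<^esub> - z)\<close> by
  \<open>e\<^bsub>k-1\<^esub> \<bullet> (z\<^bsub>k-1/2\<^esub> - z)\<close>, because \<open>\<eta> L \<le> 1\<close>
  (\<open>extragradient_half_step_inequality\<close>).

  For part (b), the full steps satisfy
  \<open>\<parallel>z\<^bsub>k+1\<^esub> - z\<^sup>*\<parallel>\<^sup>2 \<le> \<parallel>z\<^sub>k - z\<^sup>*\<parallel>\<^sup>2 - (1 - \<eta>\<^sup>2L\<^sup>2) \<parallel>z\<^bsub>k+1/2\<^esub> - z\<^sub>k\<parallel>\<^sup>2\<close>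
  (\<open>extragradient_step_descent\<close>).  Summing over \<open>k\<close> bounds both the distances
  \<open>\<parallel>z\<^sub>k - z\<^sup>*\<parallel>\<close> and the series; each half-step iterate is then close to a point that is close to \<open>z\<^sup>*\<close>.
\<close>

section \<open>The saddle operator\<close>

lemma has_gradient_imp_has_derivative_on_line:
  fixes g :: "'a::real_inner \<Rightarrow> real"
  assumes "GDERIV g x :> D"
  shows "((\<lambda>t. g (x + t *\<^sub>R v)) has_real_derivative v \<bullet> D) (at 0)"
proof -
  have "(g has_derivative (\<lambda>h. h \<bullet> D)) (at (x + 0 *\<^sub>R v))"
    using assms by (simp add: gderiv_def)
  moreover have "((\<lambda>t. x + t *\<^sub>R v) has_derivative (\<lambda>t. t *\<^sub>R v)) (at 0)"
    by (auto intro!: derivative_eq_intros)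
  ultimately have "((\<lambda>t. g (x + t *\<^sub>R v)) has_derivative (\<lambda>t. (t *\<^sub>R v) \<bullet> D)) (at 0)"
    by (rule has_derivative_compose[rotated])
  then show ?thesis
    by (simp add: has_field_derivative_def mult.commute[of _ "v \<bullet> D"])
qed

text \<open>Restricting to the line through the two points reduces the claim to the tangent inequality
  for convex functions of one real variable.\<close>

lemma convex_on_imp_above_gradient:
  fixes g :: "'a::real_inner \<Rightarrow> real"
  assumes "convex_on UNIV g" and "GDERIV g x :> D"
  shows "g x + D \<bullet> (y - x) \<le> g y"
proof -
  let ?h = "\<lambda>t. g (x + t *\<^sub>R (y - x))"
  have "convex_on UNIV ?h"
  proof (rule convex_onI)
    fix t a b :: real
    assume "0 < t" "t < 1"
    moreover have "x + ((1 - t) *\<^sub>R a + t *\<^sub>R b) *\<^sub>R (y - x)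
        = (1 - t) *\<^sub>R (x + a *\<^sub>R (y - x)) + t *\<^sub>R (x + b *\<^sub>R (y - x))"
      by (simp add: algebra_simps)
    ultimately show "?h ((1 - t) *\<^sub>R a + t *\<^sub>R b) \<le> (1 - t) * ?h a + t * ?h b"
      using convex_onD[OF assms(1), of t "x + a *\<^sub>R (y - x)" "x + b *\<^sub>R (y - x)"] by simp
  qed simp
  then have "?h 1 - ?h 0 \<ge> ((y - x) \<bullet> D) * (1 - 0)"
    using has_gradient_imp_has_derivative_on_line[OF assms(2), of "y - x"]
    by (intro convex_on_imp_above_tangent) (auto simp: has_field_derivative_at_within)
  then show ?thesis
    by (simp add: inner_commute)
qed

text \<open>The tangent inequalities in \<open>x\<close> and in \<open>y\<close> bound the inner product below by
  \<open>f (x, y\<^sup>*) - f (x\<^sup>*, y)\<close>, which is a sum of two gaps that a saddle point makes nonnegative.\<close>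

lemma saddle_operator_inner_nonneg:
  fixes f :: "'a::euclidean_space \<times> 'b::euclidean_space \<Rightarrow> real"
  assumes C1: "continuously_differentiable_xy f" and conv: "convex_concave f"
    and zs: "zs \<in> saddle_points f"
  shows "0 \<le> saddle_operator f w \<bullet> (w - zs)"
proof -
  obtain x y where w: "w = (x, y)" by (cases w)
  obtain xs ys where zs_eq: "zs = (xs, ys)" by (cases zs)
  have "f (x, y) + grad_x f w \<bullet> (xs - x) \<le> f (xs, y)"
    using C1 conv unfolding w grad_x_def
    by (intro convex_on_imp_above_gradient[of "\<lambda>x. f (x, y)"])
      (auto simp: continuously_differentiable_xy_def convex_concave_def intro!: GDERIV_gradient)
  moreover have "- f (x, y) + (- grad_y f w) \<bullet> (ys - y) \<le> - f (x, ys)"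
    using C1 conv unfolding w grad_y_def
    by (intro convex_on_imp_above_gradient[of "\<lambda>y. - f (x, y)"])
      (auto simp: continuously_differentiable_xy_def convex_concave_def concave_on_def
        intro!: GDERIV_minus GDERIV_gradient)
  moreover have "f (xs, y) \<le> f (xs, ys)" "f (xs, ys) \<le> f (x, ys)"
    using zs by (auto simp: saddle_points_def zs_eq)
  ultimately show ?thesis
    by (simp add: saddle_operator_def w zs_eq inner_diff_right)
qed

text \<open>Moving one argument at a time gives \<open>M (a + b)\<close> for each of the two blocks, where \<open>a\<close> and
  \<open>b\<close> are the displacements in \<open>x\<close> and \<open>y\<close>.  The sum of the two squares is at most
  \<open>2 M\<^sup>2 (a + b)\<^sup>2 \<le> 4 M\<^sup>2 (a\<^sup>2 + b\<^sup>2)\<close>: this is the origin of the factor 2 in \<open>L\<close>.\<close>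

lemma saddle_operator_lipschitz:
  fixes f :: "'a::real_inner \<times> 'b::real_inner \<Rightarrow> real"
  assumes xx: "\<And>x1 x2 y. norm (grad_x f (x1, y) - grad_x f (x2, y)) \<le> M * norm (x1 - x2)"
    and xy: "\<And>x y1 y2. norm (grad_x f (x, y1) - grad_x f (x, y2)) \<le> M * norm (y1 - y2)"
    and yy: "\<And>x y1 y2. norm (grad_y f (x, y1) - grad_y f (x, y2)) \<le> M * norm (y1 - y2)"
    and yx: "\<And>x1 x2 y. norm (grad_y f (x1, y) - grad_y f (x2, y)) \<le> M * norm (x1 - x2)"
    and M: "0 \<le> M"
  shows "norm (saddle_operator f u - saddle_operator f v) \<le> 2 * M * norm (u - v)"
proof -
  obtain x1 y1 where u: "u = (x1, y1)" by (cases u)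
  obtain x2 y2 where v: "v = (x2, y2)" by (cases v)
  let ?a = "norm (x1 - x2)" and ?b = "norm (y1 - y2)"
  let ?p = "norm (grad_x f u - grad_x f v)" and ?q = "norm (grad_y f u - grad_y f v)"
  have p: "?p \<le> M * (?a + ?b)"
    using norm_triangle_le[OF add_mono[OF xx[of x1 y1 x2] xy[of x2 y1 y2]]]
    by (simp add: u v algebra_simps)
  have q: "?q \<le> M * (?a + ?b)"
    using norm_triangle_le[OF add_mono[OF yx[of x1 y1 x2] yy[of x2 y1 y2]]]
    by (simp add: u v algebra_simps)
  have "(norm (saddle_operator f u - saddle_operator f v))\<^sup>2 = ?p\<^sup>2 + ?q\<^sup>2"
    by (simp add: saddle_operator_def norm_Pair norm_minus_commute)
  also have "\<dots> \<le> (M * (?a + ?b))\<^sup>2 + (M * (?a + ?b))\<^sup>2"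
    using p q by (intro add_mono power_mono) auto
  also have "\<dots> = M\<^sup>2 * (2 * (?a + ?b)\<^sup>2)"
    by (simp add: power_mult_distrib)
  also have "\<dots> \<le> M\<^sup>2 * (4 * (?a\<^sup>2 + ?b\<^sup>2))"
    using zero_le_power2[of "?a - ?b"]
    by (intro mult_left_mono) (auto simp: power2_eq_square algebra_simps)
  also have "\<dots> = (2 * M * norm (u - v))\<^sup>2"
    by (simp add: u v norm_Pair power_mult_distrib)
  finally show ?thesis
    by (rule power2_le_imp_le) (use M in auto)
qed

text \<open>A nontrivial space has two distinct points, so the left-hand side forces the sign of the
  constant.\<close>

lemma lipschitz_constant_nonneg:
  fixes G :: "'a::euclidean_space \<Rightarrow> 'b::real_normed_vector"
  assumes "\<And>x1 x2. norm (G x1 - G x2) \<le> C * norm (x1 - x2)"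
  shows "0 \<le> C"
proof -
  obtain b :: 'a where "b \<in> Basis"
    using nonempty_Basis by blast
  then show ?thesis
    using order_trans[OF norm_ge_zero assms[of b 0]] by simp
qed

section \<open>Extragradient steps for a Lipschitz operator\<close>

lemma extragradient_half_step_inequality:
  fixes F :: "'v::real_inner \<Rightarrow> 'v"
  assumes EG: "extragradient_iterates F \<eta> z zh"
    and lip: "\<And>u v. norm (F u - F v) \<le> L * norm (u - v)"
    and L: "0 \<le> L" and \<eta>: "0 < \<eta>" and \<eta>L: "\<eta> * L \<le> 1"
  shows "F (zh (Suc k)) \<bullet> (zh (Suc k) - w)
    \<le> 1 / (2 * \<eta>) * (norm (zh k - w))\<^sup>2 - 1 / (2 * \<eta>) * (norm (zh (Suc k) - w))\<^sup>2
      + L / 2 * (norm (zh k - z k))\<^sup>2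
      + (F (zh (Suc k)) - F (z (Suc k))) \<bullet> (zh (Suc k) - w)
      - (F (zh k) - F (z k)) \<bullet> (zh k - w)"
proof -
  define u p where "u = zh (Suc k)" and "p = zh k"
  define e where "e = F p - F (z k)"
  have p: "p = z k - \<eta> *\<^sub>R F (z k)" and u: "u = (z k - \<eta> *\<^sub>R F p) - \<eta> *\<^sub>R F (z (Suc k))"
    using EG unfolding extragradient_iterates_def u_def p_def by metis+
  have "p - u = (z k - \<eta> *\<^sub>R F (z k)) - ((z k - \<eta> *\<^sub>R F p) - \<eta> *\<^sub>R F (z (Suc k)))"
    by (rule arg_cong2[where f = minus, OF p u])
  also have "\<dots> = \<eta> *\<^sub>R (F (z (Suc k)) + e)"
    by (simp add: e_def algebra_simps)
  finally have "(p - u) \<bullet> (u - w) = \<eta> * ((F (z (Suc k)) + e) \<bullet> (u - w))"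
    by simp
  moreover have "2 * ((p - u) \<bullet> (u - w)) = (norm (p - w))\<^sup>2 - (norm (u - w))\<^sup>2 - (norm (p - u))\<^sup>2"
    by (simp add: power2_norm_eq_inner algebra_simps inner_commute)
  ultimately have main: "(F (z (Suc k)) + e) \<bullet> (u - w)
      = 1 / (2 * \<eta>) * ((norm (p - w))\<^sup>2 - (norm (u - w))\<^sup>2 - (norm (p - u))\<^sup>2)"
    using \<eta> by (simp add: field_simps)
  have "e \<bullet> (p - u) \<le> norm e * norm (p - u)"
    by (rule norm_cauchy_schwarz)
  also have "\<dots> \<le> (L * norm (p - z k)) * norm (p - u)"
    unfolding e_def by (intro mult_right_mono lip) simp
  also have "\<dots> \<le> L / 2 * ((norm (p - z k))\<^sup>2 + (norm (p - u))\<^sup>2)"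
    using mult_left_mono[OF sum_squares_bound[of "norm (p - z k)" "norm (p - u)"] L]
    by (simp add: field_simps)
  also have "\<dots> \<le> L / 2 * (norm (p - z k))\<^sup>2 + 1 / (2 * \<eta>) * (norm (p - u))\<^sup>2"
  proof -
    have "L / 2 \<le> 1 / (2 * \<eta>)"
      using \<eta> \<eta>L by (simp add: field_simps)
    then have "L / 2 * (norm (p - u))\<^sup>2 \<le> 1 / (2 * \<eta>) * (norm (p - u))\<^sup>2"
      by (rule mult_right_mono) simp
    then show ?thesis
      by (simp add: distrib_left)
  qed
  finally have "e \<bullet> (p - u) \<le> \<dots>" .
  moreover have "F u \<bullet> (u - w)
      = (F (z (Suc k)) + e) \<bullet> (u - w) + (F u - F (z (Suc k))) \<bullet> (u - w)
        - e \<bullet> (p - w) + e \<bullet> (p - u)"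
    by (simp add: algebra_simps)
  ultimately show ?thesis
    using main by (simp add: u_def p_def e_def right_diff_distrib)
qed

text \<open>Expanding the square leaves \<open>- 2 \<eta> F(z\<^bsub>k+1/2\<^esub>) \<bullet> (z\<^bsub>k+1/2\<^esub> - z\<^sup>*) \<le> 0\<close> and
  \<open>\<eta>\<^sup>2 \<parallel>F(z\<^bsub>k+1/2\<^esub>) - F(z\<^sub>k)\<parallel>\<^sup>2 - \<parallel>\<eta> F(z\<^sub>k)\<parallel>\<^sup>2\<close>, where \<open>\<eta> F(z\<^sub>k) = z\<^sub>k - z\<^bsub>k+1/2\<^esub>\<close>.\<close>

lemma extragradient_step_descent:
  fixes F :: "'v::real_inner \<Rightarrow> 'v"
  assumes EG: "extragradient_iterates F \<eta> z zh"
    and lip: "\<And>u v. norm (F u - F v) \<le> L * norm (u - v)"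
    and pos: "\<And>u. 0 \<le> F u \<bullet> (u - zs)" and \<eta>: "0 \<le> \<eta>"
  shows "(norm (z (Suc k) - zs))\<^sup>2
    \<le> (norm (z k - zs))\<^sup>2 - (1 - \<eta>\<^sup>2 * L\<^sup>2) * (norm (zh k - z k))\<^sup>2"
proof -
  define g h where "g = F (z k)" and "h = F (zh k)"
  have zh: "zh k = z k - \<eta> *\<^sub>R g" and z: "z (Suc k) = z k - \<eta> *\<^sub>R h"
    using EG by (auto simp: extragradient_iterates_def g_def h_def)
  have "(norm (z (Suc k) - zs))\<^sup>2 = (norm (z k - zs))\<^sup>2 - 2 * \<eta> * (h \<bullet> (zh k - zs))
      + \<eta>\<^sup>2 * (norm (h - g))\<^sup>2 - (norm (zh k - z k))\<^sup>2"
    unfolding z zh power2_norm_eq_inner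
    by (simp add: algebra_simps inner_commute power2_eq_square)
  also have "\<dots> \<le> (norm (z k - zs))\<^sup>2 - 0 + \<eta>\<^sup>2 * (L * norm (zh k - z k))\<^sup>2 - (norm (zh k - z k))\<^sup>2"
    using pos[of "zh k"] \<eta> lip[of "zh k" "z k"]
    by (intro diff_mono add_mono mult_left_mono power_mono) (auto simp: g_def h_def)
  finally show ?thesis
    by (simp add: algebra_simps power_mult_distrib)
qed

lemma extragradient_energy_bound:
  fixes F :: "'v::real_inner \<Rightarrow> 'v"
  assumes EG: "extragradient_iterates F \<eta> z zh"
    and lip: "\<And>u v. norm (F u - F v) \<le> L * norm (u - v)"
    and pos: "\<And>u. 0 \<le> F u \<bullet> (u - zs)" and \<eta>: "0 \<le> \<eta>"
  shows "(norm (z n - zs))\<^sup>2 + (1 - \<eta>\<^sup>2 * L\<^sup>2) * (\<Sum>k<n. (norm (zh k - z k))\<^sup>2) \<le> (norm (z 0 - zs))\<^sup>2"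
proof (induction n)
  case (Suc n)
  then show ?case
    using extragradient_step_descent[OF EG lip pos \<eta>, of n] by (simp add: distrib_left)
qed simp

lemma extragradient_partial_sum_le:
  fixes F :: "'v::real_inner \<Rightarrow> 'v"
  assumes EG: "extragradient_iterates F \<eta> z zh"
    and lip: "\<And>u v. norm (F u - F v) \<le> L * norm (u - v)"
    and pos: "\<And>u. 0 \<le> F u \<bullet> (u - zs)" and \<eta>: "0 \<le> \<eta>" and \<eta>L: "\<eta>\<^sup>2 * L\<^sup>2 < 1"
  shows "(\<Sum>k<n. (norm (zh k - z k))\<^sup>2) \<le> (norm (z 0 - zs))\<^sup>2 / (1 - \<eta>\<^sup>2 * L\<^sup>2)"
proof -
  have "(1 - \<eta>\<^sup>2 * L\<^sup>2) * (\<Sum>k<n. (norm (zh k - z k))\<^sup>2) \<le> (norm (z 0 - zs))\<^sup>2"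
    using extragradient_energy_bound[OF EG lip pos \<eta>, of n] zero_le_power2[of "norm (z n - zs)"]
    by linarith
  then show ?thesis
    using \<eta>L by (simp add: pos_le_divide_eq mult.commute)
qed

lemma extragradient_square_summable:
  fixes F :: "'v::real_inner \<Rightarrow> 'v"
  assumes EG: "extragradient_iterates F \<eta> z zh"
    and lip: "\<And>u v. norm (F u - F v) \<le> L * norm (u - v)"
    and pos: "\<And>u. 0 \<le> F u \<bullet> (u - zs)" and \<eta>: "0 \<le> \<eta>" and \<eta>L: "\<eta>\<^sup>2 * L\<^sup>2 < 1"
  shows "summable (\<lambda>k. (norm (zh k - z k))\<^sup>2)"
    and "(\<Sum>k. (norm (zh k - z k))\<^sup>2) \<le> (norm (z 0 - zs))\<^sup>2 / (1 - \<eta>\<^sup>2 * L\<^sup>2)"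
proof -
  note partial = extragradient_partial_sum_le[OF EG lip pos \<eta> \<eta>L]
  show summable: "summable (\<lambda>k. (norm (zh k - z k))\<^sup>2)"
    by (rule summableI_nonneg_bounded[OF _ partial]) simp
  show "(\<Sum>k. (norm (zh k - z k))\<^sup>2) \<le> (norm (z 0 - zs))\<^sup>2 / (1 - \<eta>\<^sup>2 * L\<^sup>2)"
    by (rule suminf_le_const[OF summable partial])
qed

text \<open>The triangle inequality through \<open>z\<^sub>k\<close> bounds the half-step iterates; squaring it costs the
  factor 2 in both summands of the radius.\<close>

lemma extragradient_iterates_bounded:
  fixes F :: "'v::real_inner \<Rightarrow> 'v"
  assumes EG: "extragradient_iterates F \<eta> z zh"
    and lip: "\<And>u v. norm (F u - F v) \<le> L * norm (u - v)"
    and pos: "\<And>u. 0 \<le> F u \<bullet> (u - zs)" and \<eta>: "0 \<le> \<eta>" and \<eta>L: "\<eta>\<^sup>2 * L\<^sup>2 < 1"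
  shows "(norm (z k - zs))\<^sup>2 \<le> (norm (z 0 - zs))\<^sup>2"
    and "(norm (zh k - zs))\<^sup>2 \<le> (2 + 2 / (1 - \<eta>\<^sup>2 * L\<^sup>2)) * (norm (z 0 - zs))\<^sup>2"
proof -
  have "0 \<le> (1 - \<eta>\<^sup>2 * L\<^sup>2) * (\<Sum>i<k. (norm (zh i - z i))\<^sup>2)"
    using \<eta>L by (intro mult_nonneg_nonneg sum_nonneg) auto
  then show z: "(norm (z k - zs))\<^sup>2 \<le> (norm (z 0 - zs))\<^sup>2"
    using extragradient_energy_bound[OF EG lip pos \<eta>, of k] by linarith
  have "(norm (zh k - z k))\<^sup>2 \<le> (\<Sum>i<Suc k. (norm (zh i - z i))\<^sup>2)"
    by (rule member_le_sum) auto
  also have "\<dots> \<le> (norm (z 0 - zs))\<^sup>2 / (1 - \<eta>\<^sup>2 * L\<^sup>2)"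
    by (rule extragradient_partial_sum_le[OF EG lip pos \<eta> \<eta>L])
  finally have zh: "(norm (zh k - z k))\<^sup>2 \<le> (norm (z 0 - zs))\<^sup>2 / (1 - \<eta>\<^sup>2 * L\<^sup>2)" .
  have "norm (zh k - zs) \<le> norm (zh k - z k) + norm (z k - zs)"
    using norm_triangle_ineq[of "zh k - z k" "z k - zs"] by simp
  then have "(norm (zh k - zs))\<^sup>2 \<le> (norm (zh k - z k) + norm (z k - zs))\<^sup>2"
    by (rule power_mono) simp
  also have "\<dots> \<le> 2 * (norm (zh k - z k))\<^sup>2 + 2 * (norm (z k - zs))\<^sup>2"
    using sum_squares_bound[of "norm (zh k - z k)" "norm (z k - zs)"] by (simp add: power2_sum)
  also have "\<dots> \<le> 2 * ((norm (z 0 - zs))\<^sup>2 / (1 - \<eta>\<^sup>2 * L\<^sup>2)) + 2 * (norm (z 0 - zs))\<^sup>2"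
    using z zh by (intro add_mono mult_left_mono) auto
  also have "\<dots> = (2 + 2 / (1 - \<eta>\<^sup>2 * L\<^sup>2)) * (norm (z 0 - zs))\<^sup>2"
    by (simp add: distrib_right)
  finally show "(norm (zh k - zs))\<^sup>2 \<le> (2 + 2 / (1 - \<eta>\<^sup>2 * L\<^sup>2)) * (norm (z 0 - zs))\<^sup>2" .
qed

section \<open>The region containing the iterates\<close>

lemma mem_eg_region_iff:
  fixes z0 zs w :: "'a::real_inner \<times> 'b::real_inner"
  shows "w \<in> eg_region L \<eta> z0 zs
    \<longleftrightarrow> (norm (w - zs))\<^sup>2 \<le> (2 + 2 / (1 - \<eta>\<^sup>2 * L\<^sup>2)) * (norm (z0 - zs))\<^sup>2"
  by (cases w; cases z0; cases zs) (simp add: eg_region_def norm_Pair)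

lemma compact_eg_region:
  fixes z0 zs :: "'a::euclidean_space \<times> 'b::euclidean_space"
  shows "compact (eg_region L \<eta> z0 zs)"
proof -
  define r where "r = (2 + 2 / (1 - \<eta>\<^sup>2 * L\<^sup>2)) * (norm (z0 - zs))\<^sup>2"
  \<comment> \<open>If \<open>r < 0\<close>, both sides are empty, since then \<open>sqrt r < 0\<close>.\<close>
  have "eg_region L \<eta> z0 zs = cball zs (sqrt r)"
  proof (rule set_eqI)
    fix w
    have "(norm (w - zs))\<^sup>2 \<le> r \<longleftrightarrow> norm (w - zs) \<le> sqrt r"
      by (metis norm_ge_zero real_le_rsqrt real_sqrt_le_iff real_sqrt_pow2_iff real_sqrt_unique)
    then show "w \<in> eg_region L \<eta> z0 zs \<longleftrightarrow> w \<in> cball zs (sqrt r)"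
      by (simp add: mem_eg_region_iff r_def dist_norm norm_minus_commute)
  qed
  then show ?thesis
    by simp
qed

section \<open>The extragradient method for convex-concave saddle point problems\<close>

theorem lemma3:
  fixes f :: "(real ^ 'm) \<times> (real ^ 'n) \<Rightarrow> real"
    and F :: "(real ^ 'm) \<times> (real ^ 'n) \<Rightarrow> (real ^ 'm) \<times> (real ^ 'n)"
    and z zh :: "nat \<Rightarrow> (real ^ 'm) \<times> (real ^ 'n)"
    and Lxx Lxy Lyx Lyy L \<eta> :: real
  assumes C1: "continuously_differentiable_xy f"
    and conv: "convex_concave f"
    and Lxx: "\<And>x1 x2 y. norm (grad_x f (x1, y) - grad_x f (x2, y)) \<le> Lxx * norm (x1 - x2)"
    and Lxy: "\<And>x y1 y2. norm (grad_x f (x, y1) - grad_x f (x, y2)) \<le> Lxy * norm (y1 - y2)"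
    and Lyy: "\<And>x y1 y2. norm (grad_y f (x, y1) - grad_y f (x, y2)) \<le> Lyy * norm (y1 - y2)"
    and Lyx: "\<And>x1 x2 y. norm (grad_y f (x1, y) - grad_y f (x2, y)) \<le> Lyx * norm (x1 - x2)"
    and L: "L = 2 * Max {Lxx, Lxy, Lyx, Lyy}"
    and saddle: "saddle_points f \<noteq> {}"
    and F: "F = saddle_operator f"
    and EG: "extragradient_iterates F \<eta> z zh"
    and \<eta>_pos: "0 < \<eta>"
    \<comment> \<open>For \<open>L = 0\<close> the bound \<open>1 / L\<close> is read as infinity, not as the library's \<open>1 / 0 = 0\<close>.\<close>
    and \<eta>_less: "L \<noteq> 0 \<Longrightarrow> \<eta> < 1 / L"
  shows "(\<forall>w. \<forall>k\<ge>1.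
            F (zh k) \<bullet> (zh k - w)
              \<le> 1 / (2 * \<eta>) * (norm (zh (k - 1) - w))\<^sup>2
                - 1 / (2 * \<eta>) * (norm (zh k - w))\<^sup>2
                + L / 2 * (norm (zh (k - 1) - z (k - 1)))\<^sup>2
                + (F (zh k) - F (z k)) \<bullet> (zh k - w)
                - (F (zh (k - 1)) - F (z (k - 1))) \<bullet> (zh (k - 1) - w))
       \<and> (\<forall>zs \<in> saddle_points f.
            compact (eg_region L \<eta> (z 0) zs)
            \<and> (\<forall>k. z k \<in> eg_region L \<eta> (z 0) zs \<and> zh k \<in> eg_region L \<eta> (z 0) zs)
            \<and> summable (\<lambda>k. (norm (zh k - z k))\<^sup>2)
            \<and> (\<Sum>k. (norm (zh k - z k))\<^sup>2) \<le> (norm (z 0 - zs))\<^sup>2 / (1 - \<eta>\<^sup>2 * L\<^sup>2))"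
proof -
  define M where "M = Max {Lxx, Lxy, Lyx, Lyy}"
  have M_ge: "Lxx \<le> M" "Lxy \<le> M" "Lyx \<le> M" "Lyy \<le> M"
    by (auto simp: M_def)
  have "0 \<le> Lxx"
    using lipschitz_constant_nonneg[of "\<lambda>x. grad_x f (x, undefined)"] Lxx by blast
  then have M_nonneg: "0 \<le> M"
    using M_ge by linarith
  have lip: "norm (F u - F v) \<le> L * norm (u - v)" for u v
  proof -
    note weaken = mult_right_mono[OF _ norm_ge_zero]
    show ?thesis
      unfolding F L M_def[symmetric]
      using M_nonneg
      by (intro saddle_operator_lipschitz)
        (blast intro: M_ge order_trans[OF Lxx weaken] order_trans[OF Lxy weaken]
          order_trans[OF Lyy weaken] order_trans[OF Lyx weaken])+
  qed
  have L_nonneg: "0 \<le> L"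
    using M_nonneg by (simp add: L M_def)
  have \<eta>L: "0 \<le> \<eta> * L" "\<eta> * L < 1"
    using \<eta>_pos \<eta>_less L_nonneg by (cases "L = 0"; simp add: field_simps)+
  then have \<eta>L_sq: "\<eta>\<^sup>2 * L\<^sup>2 < 1"
    by (simp add: power_mult_distrib[symmetric] power_less_one_iff abs_square_less_1)
  have \<eta>_nonneg: "0 \<le> \<eta>"
    using \<eta>_pos by simp
  show ?thesis
  proof (intro conjI allI impI ballI)
    fix w and k :: nat
    assume "1 \<le> k"
    then show "F (zh k) \<bullet> (zh k - w)
              \<le> 1 / (2 * \<eta>) * (norm (zh (k - 1) - w))\<^sup>2
                - 1 / (2 * \<eta>) * (norm (zh k - w))\<^sup>2
                + L / 2 * (norm (zh (k - 1) - z (k - 1)))\<^sup>2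
                + (F (zh k) - F (z k)) \<bullet> (zh k - w)
                - (F (zh (k - 1)) - F (z (k - 1))) \<bullet> (zh (k - 1) - w)"
      using extragradient_half_step_inequality
          [OF EG lip L_nonneg \<eta>_pos less_imp_le[OF \<eta>L(2)], of "k - 1" w]
      by simp
  next
    fix zs
    assume "zs \<in> saddle_points f"
    then have pos: "0 \<le> F u \<bullet> (u - zs)" for u
      unfolding F by (rule saddle_operator_inner_nonneg[OF C1 conv])
    show "compact (eg_region L \<eta> (z 0) zs)"
      by (rule compact_eg_region)
    have "1 * (norm (z 0 - zs))\<^sup>2 \<le> (2 + 2 / (1 - \<eta>\<^sup>2 * L\<^sup>2)) * (norm (z 0 - zs))\<^sup>2"
      using \<eta>L_sq by (intro mult_right_mono) (simp_all add: add_increasing2)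
    then show "z k \<in> eg_region L \<eta> (z 0) zs" for k
      using extragradient_iterates_bounded(1)[OF EG lip pos \<eta>_nonneg \<eta>L_sq, of k]
      unfolding mem_eg_region_iff by linarith
    show "zh k \<in> eg_region L \<eta> (z 0) zs" for k
      unfolding mem_eg_region_iff
      by (rule extragradient_iterates_bounded(2)[OF EG lip pos \<eta>_nonneg \<eta>L_sq])
    show "summable (\<lambda>k. (norm (zh k - z k))\<^sup>2)"
      by (rule extragradient_square_summable(1)[OF EG lip pos \<eta>_nonneg \<eta>L_sq])
    show "(\<Sum>k. (norm (zh k - z k))\<^sup>2) \<le> (norm (z 0 - zs))\<^sup>2 / (1 - \<eta>\<^sup>2 * L\<^sup>2)"
      by (rule extragradient_square_summable(2)[OF EG lip pos \<eta>_nonneg \<eta>L_sq])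
  qed
qed

end
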